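(* For all real $a,b>0$ with $a\neq b$, writing $A,G,X$ for $A(a,b),G(a,b),X(a,b)$ and $M_p=M_p(a,b)$, $H_\alpha=H_\alpha(a,b)$, one has $$M_p\leq M_{1/3}<\frac{2G+A}{3}<X\quad\text{for every real } p\leq \tfrac13,$$ and $$H_\alpha\leq H_{1/2}<\frac{2G+A}{3}<X\quad\text{for every real } \alpha\leq \tfrac12.$$
   Context: For real $a,b>0$ with $a\neq b$: $A(a,b)=\frac{a+b}{2}$, $G(a,b)=\sqrt{ab}$, $P(a,b)=\dfrac{a-b}{2\arcsin\left(\frac{a-b}{a+b}\right)}$ (Seiffert mean), and $X(a,b)=A\,e^{G/P-1}$. For $p\in\mathbb{R}$ the power mean is $M_p(a,b)=\left(\frac{a^p+b^p}{2}\right)^{1/p}$ if $p\neq0$ and $M_0(a,b)=\sqrt{ab}$; the power-type Heronian mean is $H_p(a,b)=\left(\frac{a^p+(ab)^{p/2}+b^p}{3}\right)^{1/p}$ if $p\neq0$ and $H_0(a,b)=\sqrt{ab}$. *)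

theory Defs
  imports Complex_Main
begin

text \<open>
  Bivariate means of positive reals. The Seiffert mean and the mean X are only meaningful
  for \<open>a \<noteq> b\<close>; on the diagonal the Seiffert formula degenerates to \<open>0 / 0 = 0\<close>.
\<close>

definition mean_A :: "real \<Rightarrow> real \<Rightarrow> real" where
  "mean_A a b = (a + b) / 2"

definition mean_G :: "real \<Rightarrow> real \<Rightarrow> real" where
  "mean_G a b = sqrt (a * b)"

definition mean_P :: "real \<Rightarrow> real \<Rightarrow> real" where
  "mean_P a b = (a - b) / (2 * arcsin ((a - b) / (a + b)))"

definition mean_X :: "real \<Rightarrow> real \<Rightarrow> real" where
  "mean_X a b = mean_A a b * exp (mean_G a b / mean_P a b - 1)"

definition power_mean :: "real \<Rightarrow> real \<Rightarrow> real \<Rightarrow> real" where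
  "power_mean p a b =
     (if p = 0 then sqrt (a * b) else ((a powr p + b powr p) / 2) powr (1 / p))"

definition heronian_mean :: "real \<Rightarrow> real \<Rightarrow> real \<Rightarrow> real" where
  "heronian_mean p a b =
     (if p = 0 then sqrt (a * b)
      else ((a powr p + (a * b) powr (p / 2) + b powr p) / 3) powr (1 / p))"

end

theory Submission
  imports Defs "HOL-Analysis.Analysis"
begin

text \<open>
  Monotonicity of the means in the exponent, from \<open>p\<close> up to a positive \<open>q\<close>, comes from Bernoulli's
  inequality applied to the \<open>q\<close>-th powers divided by their average. The bounds for \<open>M\<^sub>1\<^sub>/\<^sub>3\<close> and
  \<open>H\<^sub>1\<^sub>/\<^sub>2\<close> are polynomial in \<open>s = x + y\<close> and \<open>t = sqrt (x y)\<close>, where \<open>x\<close>, \<open>y\<close> are the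
  cube or square roots of \<open>a\<close>, \<open>b\<close>: they amount to \<open>(s - 2 t)\<^sup>2 (s + 4 t) > 0\<close> and
  \<open>(s - 2 t)\<^sup>2 > 0\<close>. Finally, with \<open>sin \<theta> = \<bar>a - b\<bar> / (a + b)\<close> we have \<open>G / A = cos \<theta>\<close> and
  \<open>X / A = exp (\<theta> cot \<theta> - 1)\<close>, so the last inequality says that
  \<open>\<theta> cot \<theta> - 1 - ln ((2 cos \<theta> + 1) / 3)\<close> is positive. This function tends to \<open>0\<close> as \<open>\<theta> \<rightarrow> 0\<close>
  and is increasing, because \<open>\<theta> < sin \<theta> (cos \<theta> + 2) / (2 cos \<theta> + 1)\<close>.
\<close>

section \<open>Monotonicity of power means\<close>

text \<open>Weighted AM-GM for \<open>t\<close> and \<open>1\<close> with weights \<open>r\<close>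
  and \<open>1 - r\<close>.\<close>

lemma Bernoulli_powr_le:
  fixes t r :: real
  assumes "t > 0" "0 \<le> r" "r \<le> 1"
  shows "t powr r \<le> 1 + r * (t - 1)"
  using Youngs_inequality_0[of r "1 - r" t 1] assms by (simp add: algebra_simps)

text \<open>With weights \<open>1 / (1 - r)\<close> and \<open>-r / (1 - r)\<close>, the geometric
  mean of \<open>t powr r\<close> and \<open>t\<close> is \<open>1\<close>; AM-GM multiplied by
  \<open>1 - r\<close> gives the claim.\<close>

lemma Bernoulli_powr_ge:
  fixes t r :: real
  assumes "t > 0" "r \<le> 0"
  shows "1 + r * (t - 1) \<le> t powr r"
proof -
  have "1 = (t powr r) powr (1 / (1 - r)) * t powr (-r / (1 - r))"
    using assms by (simp add: powr_powr flip: powr_add add_divide_distrib)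
  also have "\<dots> \<le> (1 / (1 - r)) * t powr r + (-r / (1 - r)) * t"
    using assms by (intro Youngs_inequality_0) (auto simp: divide_simps)
  also have "\<dots> = (t powr r - r * t) / (1 - r)"
    by (simp add: diff_divide_distrib)
  finally show ?thesis
    using assms by (simp add: field_simps)
qed

lemma weighted_sum_pos:
  fixes w x :: "'a \<Rightarrow> real"
  assumes "finite S" "\<And>i. i \<in> S \<Longrightarrow> w i \<ge> 0" "sum w S = 1" "\<And>i. i \<in> S \<Longrightarrow> x i > 0"
  shows "(\<Sum>i\<in>S. w i * x i) > 0"
proof -
  obtain i where "i \<in> S" "w i \<noteq> 0"
    using assms(3) by (metis sum.neutral zero_neq_one)
  then show ?thesis
    using assms by (intro sum_pos2[of S i]) (auto simp: less_le)
qed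

lemma weighted_power_mean_mono:
  fixes w x :: "'a \<Rightarrow> real"
  assumes "finite S" "\<And>i. i \<in> S \<Longrightarrow> w i \<ge> 0" "sum w S = 1" "\<And>i. i \<in> S \<Longrightarrow> x i > 0"
    and "p \<noteq> 0" "p \<le> q" "q > 0"
  shows "(\<Sum>i\<in>S. w i * x i powr p) powr (1 / p) \<le> (\<Sum>i\<in>S. w i * x i powr q) powr (1 / q)"
proof -
  define M where "M = (\<Sum>i\<in>S. w i * x i powr q)"
  define r where "r = p / q"
  define t where "t i = x i powr q / M" for i
  have M: "M > 0"
    unfolding M_def using assms(4) by (intro weighted_sum_pos assms(1-3)) force+
  have t: "t i > 0" if "i \<in> S" for i
    using assms(4)[OF that] M by (simp add: t_def)
  have "(\<Sum>i\<in>S. w i * t i) = (\<Sum>i\<in>S. w i * x i powr q) / M"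
    by (simp add: t_def sum_divide_distrib)
  also have "\<dots> = 1"
    using M by (simp add: M_def)
  finally have wt: "(\<Sum>i\<in>S. w i * t i) = 1" .
  \<comment> \<open>As the \<open>t i\<close> average to \<open>1\<close>, the linear Bernoulli
    bounds average to exactly \<open>1\<close>.\<close>
  have "(\<Sum>i\<in>S. w i * (1 + r * (t i - 1))) = (1 - r) * sum w S + r * (\<Sum>i\<in>S. w i * t i)"
    by (simp add: sum_distrib_left algebra_simps sum.distrib sum_subtractf)
  then have lin: "(\<Sum>i\<in>S. w i * (1 + r * (t i - 1))) = 1"
    using wt assms(3) by simp
  have "x i powr p = M powr r * t i powr r" if "i \<in> S" for i
    using assms(4)[OF that] \<open>q > 0\<close> M by (simp add: t_def r_def powr_divide powr_powr)
  then have sum_p: "(\<Sum>i\<in>S. w i * x i powr p) = M powr r * (\<Sum>i\<in>S. w i * t i powr r)"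
    by (simp add: sum_distrib_left mult_ac)
  have Mr: "(M powr r) powr (1 / p) = M powr (1 / q)"
    using assms(5,7) by (simp add: powr_powr r_def)
  \<comment> \<open>Bernoulli puts the sum at or below \<open>1\<close> for \<open>p > 0\<close> and
    at or above \<open>1\<close> for \<open>p < 0\<close>; the outer exponent \<open>1 / p\<close>
    has the sign of \<open>p\<close>, so the power is at most \<open>1\<close> either way.\<close>
  have "(\<Sum>i\<in>S. w i * t i powr r) powr (1 / p) \<le> 1"
  proof (cases "p > 0")
    case True
    then have r: "0 \<le> r" "r \<le> 1"
      using assms(6,7) by (auto simp: r_def)
    have "(\<Sum>i\<in>S. w i * t i powr r) \<le> (\<Sum>i\<in>S. w i * (1 + r * (t i - 1)))"
      by (intro sum_mono mult_left_mono Bernoulli_powr_le t r assms(2))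
    then show ?thesis
      unfolding lin using True assms(2) by (intro powr_le1) (auto simp: abs_of_nonneg sum_nonneg)
  next
    case False
    then have r: "r \<le> 0"
      using assms(7) by (auto simp: r_def divide_le_0_iff)
    have "(\<Sum>i\<in>S. w i * (1 + r * (t i - 1))) \<le> (\<Sum>i\<in>S. w i * t i powr r)"
      by (intro sum_mono mult_left_mono Bernoulli_powr_ge t r assms(2))
    then show ?thesis
      unfolding lin using False powr_mono2'[of "1 / p" 1] by simp
  qed
  then have "(M powr r) powr (1 / p) * (\<Sum>i\<in>S. w i * t i powr r) powr (1 / p) \<le> M powr (1 / q)"
    unfolding Mr by (simp add: mult_left_le)
  moreover have "(\<Sum>i\<in>S. w i * t i powr r) \<ge> 0"
    using assms(2) by (auto intro!: sum_nonneg)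
  ultimately show ?thesis
    unfolding sum_p M_def[symmetric] by (simp add: powr_mult)
qed

text \<open>The limiting case of exponent \<open>0\<close>: Bernoulli is replaced by
  \<open>ln u \<le> u - 1\<close> at \<open>u = x i powr q / M\<close>, and these values again
  average to \<open>1\<close>.\<close>

lemma weighted_geometric_mean_le_power_mean:
  fixes w x :: "'a \<Rightarrow> real"
  assumes "finite S" "\<And>i. i \<in> S \<Longrightarrow> w i \<ge> 0" "sum w S = 1" "\<And>i. i \<in> S \<Longrightarrow> x i > 0"
    and "q > 0"
  shows "exp (\<Sum>i\<in>S. w i * ln (x i)) \<le> (\<Sum>i\<in>S. w i * x i powr q) powr (1 / q)"
proof -
  define M where "M = (\<Sum>i\<in>S. w i * x i powr q)"
  have M: "M > 0"
    unfolding M_def using assms(4) by (intro weighted_sum_pos assms(1-3)) force+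
  have "q * ln (x i) \<le> x i powr q / M - 1 + ln M" if "i \<in> S" for i
    using ln_le_minus_one[of "x i powr q / M"] assms(4)[OF that] M
    by (simp add: ln_div ln_powr)
  then have "(\<Sum>i\<in>S. w i * (q * ln (x i))) \<le> (\<Sum>i\<in>S. w i * (x i powr q / M - 1 + ln M))"
    by (intro sum_mono mult_left_mono assms(2)) auto
  also have "\<dots> = (\<Sum>i\<in>S. w i * x i powr q) / M + (ln M - 1) * sum w S"
    by (simp add: sum_distrib_left sum_divide_distrib algebra_simps sum.distrib sum_subtractf)
  also have "\<dots> = ln M"
    using M assms(3) by (simp add: M_def)
  finally have "(\<Sum>i\<in>S. w i * ln (x i)) \<le> ln M / q"
    using assms(5) by (simp add: pos_le_divide_eq sum_distrib_left mult_ac)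
  then show ?thesis
    using M by (simp add: M_def powr_def)
qed

text \<open>The general inequalities with weights \<open>1 / 2\<close> over \<open>{a, b}\<close>,
  which has two elements since \<open>a \<noteq> b\<close>; exponent \<open>0\<close> is the
  geometric mean.\<close>

lemma power_mean_le:
  assumes "a > 0" "b > 0" "a \<noteq> b" "p \<le> q" "q > 0"
  shows "power_mean p a b \<le> power_mean q a b"
proof (cases "p = 0")
  case True
  have "sqrt (a * b) = exp (\<Sum>x\<in>{a, b}. 1 / 2 * ln x)"
    using assms by (simp add: exp_add real_sqrt_mult flip: ln_sqrt)
  then show ?thesis
    using weighted_geometric_mean_le_power_mean[of "{a, b}" "\<lambda>_. 1 / 2" "\<lambda>x. x" q] assms True
    by (force simp: power_mean_def add_divide_distrib)
next
  case False
  then show ?thesis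
    using weighted_power_mean_mono[of "{a, b}" "\<lambda>_. 1 / 2" "\<lambda>x. x" p q] assms
    by (force simp: power_mean_def add_divide_distrib)
qed

text \<open>Since \<open>(a * b) powr (p / 2) = g powr p\<close>, the Heronian mean is the equally
  weighted power mean of \<open>a\<close>, \<open>g\<close>, \<open>b\<close>, whose geometric mean
  is again \<open>g\<close>.\<close>

lemma heronian_mean_le:
  assumes "a > 0" "b > 0" "a \<noteq> b" "p \<le> q" "q > 0"
  shows "heronian_mean p a b \<le> heronian_mean q a b"
proof -
  define g where "g = sqrt (a * b)"
  have g: "g > 0" "g\<^sup>2 = a * b"
    using assms by (auto simp: g_def)
  have g_powr: "(a * b) powr (s / 2) = g powr s" for s
    using assms by (simp add: g_def powr_half_sqrt[symmetric] powr_powr)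
  \<comment> \<open>Distinctness gives \<open>{a, g, b}\<close> three elements, so that the weights
    \<open>1 / 3\<close> sum to \<open>1\<close>.\<close>
  have ne: "a \<noteq> g" "b \<noteq> g"
    using g assms by (auto simp: power2_eq_square)
  show ?thesis
  proof (cases "p = 0")
    case True
    have "ln g = (ln a + ln b) / 2"
      using assms by (simp add: g_def ln_sqrt ln_mult)
    then have "(\<Sum>x\<in>{a, g, b}. 1 / 3 * ln x) = ln g"
      using ne assms by (simp add: field_simps)
    then have "g = exp (\<Sum>x\<in>{a, g, b}. 1 / 3 * ln x)"
      using g by simp
    then show ?thesis
      using weighted_geometric_mean_le_power_mean[of "{a, g, b}" "\<lambda>_. 1 / 3" "\<lambda>x. x" q] assms True g ne
      by (force simp: heronian_mean_def g_powr add_divide_distrib add.assoc simp flip: g_def)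
  next
    case False
    then show ?thesis
      using weighted_power_mean_mono[of "{a, g, b}" "\<lambda>_. 1 / 3" "\<lambda>x. x" p q] assms g ne
      by (force simp: heronian_mean_def g_powr add_divide_distrib add.assoc)
  qed
qed

section \<open>Comparison with \<open>(2 G + A) / 3\<close>\<close>

lemma two_sqrt_mult_less_add:
  assumes "x > 0" "y > 0" "x \<noteq> y"
  shows "2 * sqrt (x * y) < x + y"
proof (rule power2_less_imp_less)
  show "(2 * sqrt (x * y))\<^sup>2 < (x + y)\<^sup>2"
    using assms zero_less_power2[of "x - y"] by (simp add: power2_eq_square algebra_simps)
qed (use assms in simp)

text \<open>Here \<open>A = (s^3 - 3 s t^2) / 2\<close>, \<open>G = t^3\<close> and the power mean
  is \<open>s^3 / 8\<close>, so 24 times the gap is \<open>s^3 - 12 s t^2 + 16 t^3\<close>, with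
  double root \<open>s = 2 t\<close>.\<close>

lemma power_mean_third_less:
  assumes "a > 0" "b > 0" "a \<noteq> b"
  shows "power_mean (1/3) a b < (2 * mean_G a b + mean_A a b) / 3"
proof -
  define x y where "x = a powr (1/3)" and "y = b powr (1/3)"
  define s t where "s = x + y" and "t = sqrt (x * y)"
  have xy: "x > 0" "y > 0" and a: "a = x ^ 3" and b: "b = y ^ 3"
    using assms by (simp_all add: x_def y_def powr_powr flip: powr_realpow)
  have "2 * t < s"
    unfolding s_def t_def using xy assms(3) a b by (intro two_sqrt_mult_less_add) auto
  moreover have t: "t \<ge> 0" and t2: "t\<^sup>2 = x * y"
    using xy by (auto simp: t_def)
  ultimately have "0 < (s - 2 * t)\<^sup>2 * (s + 4 * t)"
    by (intro mult_pos_pos) auto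
  also have "\<dots> = s ^ 3 - 12 * (s * t\<^sup>2) + 16 * t ^ 3"
    by algebra
  finally have "0 < s ^ 3 - 12 * (s * t\<^sup>2) + 16 * t ^ 3" .
  moreover have "a + b = s ^ 3 - 3 * (s * t\<^sup>2)"
    unfolding t2 s_def a b by algebra
  moreover have "mean_G a b = t ^ 3"
    by (simp add: mean_G_def a b t_def real_sqrt_power power_mult_distrib[symmetric])
  moreover have "power_mean (1/3) a b = (s / 2) ^ 3"
    using xy by (simp add: power_mean_def s_def x_def y_def flip: powr_realpow)
  ultimately show ?thesis
    by (simp add: mean_A_def power_divide field_simps)
qed

text \<open>Here \<open>A = (s^2 - 2 t^2) / 2\<close>, \<open>G = t^2\<close> and the Heronian mean
  is \<open>((s + t) / 3)^2\<close>, so 18 times the gap is \<open>(s - 2 t)^2\<close>.\<close>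

lemma heronian_mean_half_less:
  assumes "a > 0" "b > 0" "a \<noteq> b"
  shows "heronian_mean (1/2) a b < (2 * mean_G a b + mean_A a b) / 3"
proof -
  define x y where "x = sqrt a" and "y = sqrt b"
  define s t where "s = x + y" and "t = sqrt (x * y)"
  have xy: "x > 0" "y > 0" and a: "a = x\<^sup>2" and b: "b = y\<^sup>2"
    using assms by (simp_all add: x_def y_def)
  have "2 * t < s"
    unfolding s_def t_def using xy assms(3) a b by (intro two_sqrt_mult_less_add) auto
  then have "0 < (s - 2 * t)\<^sup>2"
    by simp
  also have "\<dots> = s\<^sup>2 - 4 * (s * t) + 4 * t\<^sup>2"
    by algebra
  finally have "0 < s\<^sup>2 - 4 * (s * t) + 4 * t\<^sup>2" .
  moreover have t2: "t\<^sup>2 = x * y"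
    using xy by (auto simp: t_def)
  then have "a + b = s\<^sup>2 - 2 * t\<^sup>2"
    unfolding s_def a b by algebra
  moreover have "mean_G a b = t\<^sup>2"
    unfolding t2 using xy by (simp add: mean_G_def a b real_sqrt_mult)
  moreover have "(a * b) powr (1 / 4) = t"
    using powr_powr[of "a * b" "1/2" "1/2"] assms
    by (simp add: t_def x_def y_def powr_half_sqrt real_sqrt_mult)
  then have "heronian_mean (1/2) a b = ((s + t) / 3)\<^sup>2"
    using xy assms \<open>t\<^sup>2 = x * y\<close>
    by (simp add: heronian_mean_def powr_half_sqrt s_def x_def y_def t_def add_ac)
  ultimately show ?thesis
    by (simp add: mean_A_def power_divide power2_sum field_simps)
qed

section \<open>Trigonometric inequalities and the bound for \<open>X\<close>\<close>

lemma less_sin_mult_cos_rational: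
  assumes "0 < x" "x < pi / 2"
  shows "x < sin x * (cos x + 2) / (2 * cos x + 1)"
proof -
  define g where "g x = sin x * (cos x + 2) / (2 * cos x + 1) - x" for x :: real
  have c: "cos u > 0" if "0 \<le> u" "u \<le> x" for u
    using that assms by (intro cos_gt_zero_pi) auto
  have g_deriv: "(g has_real_derivative 2 * (cos u - 1)\<^sup>2 * (cos u + 1) / (2 * cos u + 1)\<^sup>2) (at u)"
    if u: "0 \<le> u" "u \<le> x" for u
  proof -
    have ne: "2 * cos u + 1 \<noteq> 0"
      using c[OF u] by simp
    have "(g has_real_derivative
      ((cos u * (cos u + 2) - sin u * sin u) * (2 * cos u + 1) + 2 * (sin u * sin u) * (cos u + 2))
        / (2 * cos u + 1)\<^sup>2 - 1) (at u)"
      unfolding g_def using ne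
      by (auto intro!: derivative_eq_intros simp: power2_eq_square algebra_simps)
    moreover have "sin u * sin u = 1 - cos u * cos u"
      using sin_squared_eq[of u] by (simp add: power2_eq_square)
    ultimately have "(g has_real_derivative
      ((cos u * (cos u + 2) - (1 - cos u * cos u)) * (2 * cos u + 1)
        + 2 * (1 - cos u * cos u) * (cos u + 2)) / (2 * cos u + 1)\<^sup>2 - 1) (at u)"
      by simp
    \<comment> \<open>Written in \<open>cos u\<close> alone, the derivative factors and its sign is
      visible.\<close>
    also have "((cos u * (cos u + 2) - (1 - cos u * cos u)) * (2 * cos u + 1)
        + 2 * (1 - cos u * cos u) * (cos u + 2)) / (2 * cos u + 1)\<^sup>2 - 1
      = 2 * (cos u - 1)\<^sup>2 * (cos u + 1) / (2 * cos u + 1)\<^sup>2"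
      using ne by (simp add: divide_simps) algebra
    finally show ?thesis .
  qed
  have "g 0 < g x"
  \<comment> \<open>The derivative vanishes at \<open>0\<close>, so positivity is used on the open
    interval only, together with continuity on the closed one.\<close>
  proof (rule DERIV_pos_imp_increasing_open[OF assms(1)])
    fix u assume u: "0 < u" "u < x"
    have "cos u < cos 0"
      using u assms by (intro cos_monotone_0_pi) auto
    then have "2 * (cos u - 1)\<^sup>2 * (cos u + 1) / (2 * cos u + 1)\<^sup>2 > 0"
      using c[of u] u by (intro divide_pos_pos mult_pos_pos) auto
    then show "\<exists>y. (g has_real_derivative y) (at u) \<and> y > 0"
      using g_deriv[of u] u by auto
  next
    show "continuous_on {0..x} g"
      using DERIV_isCont[OF g_deriv] by (intro continuous_at_imp_continuous_on) auto
  qed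
  then show ?thesis
    by (simp add: g_def)
qed

lemma cos_rational_less_exp_cot:
  assumes "0 < x" "x < pi / 2"
  shows "(2 * cos x + 1) / 3 < exp (x * cot x - 1)"
proof -
  define f where "f x = x * cos x / sin x - 1 - ln ((2 * cos x + 1) / 3)" for x :: real
  have pos: "cos u > 0" "sin u > 0" if "0 < u" "u \<le> x" for u
    using that assms by (auto intro!: cos_gt_zero_pi sin_gt_zero)
  have mono: "f u < f v" if uv: "0 < u" "u < v" "v \<le> x" for u v
  proof (rule DERIV_pos_imp_increasing[OF uv(2)])
    fix z assume "u \<le> z" "z \<le> v"
    then have z: "0 < z" "z \<le> x"
      using uv by auto
    have D: "2 * cos z + 1 > 0"
      using pos[OF z] by simp
    have "(f has_real_derivative
        ((cos z - z * sin z) * sin z - z * cos z * cos z) / (sin z * sin z)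
        + 2 * sin z / (2 * cos z + 1)) (at z)"
      unfolding f_def using pos[OF z] D
      by (auto intro!: derivative_eq_intros simp: field_simps)
    \<comment> \<open>The terms merge by
      \<open>cos z * (2 * cos z + 1) + 2 * (sin z)^2 = cos z + 2\<close>.\<close>
    also have "((cos z - z * sin z) * sin z - z * cos z * cos z) / (sin z * sin z)
        + 2 * sin z / (2 * cos z + 1)
      = (sin z * (cos z + 2) / (2 * cos z + 1) - z) / (sin z)\<^sup>2"
      using pos[OF z] D
      by (simp add: divide_simps) (use sin_cos_squared_add[of z] in algebra)
    finally have "(f has_real_derivative
        (sin z * (cos z + 2) / (2 * cos z + 1) - z) / (sin z)\<^sup>2) (at z)" .
    moreover have "(sin z * (cos z + 2) / (2 * cos z + 1) - z) / (sin z)\<^sup>2 > 0"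
      using less_sin_mult_cos_rational[of z] z assms pos[OF z] by simp
    ultimately show "\<exists>y. (f has_real_derivative y) (at z) \<and> y > 0"
      by blast
  qed
  \<comment> \<open>Division by zero makes \<open>f 0 = -1\<close>, so the starting value
    \<open>0\<close> has to come from the right-hand limit.\<close>
  have "((\<lambda>u::real. sin u / u) \<longlongrightarrow> 1) (at 0)"
    using DERIV_sin[of "0 :: real"] by (simp add: has_field_derivative_iff)
  then have "((\<lambda>u::real. inverse (sin u / u)) \<longlongrightarrow> inverse 1) (at_right 0)"
    by (intro tendsto_inverse) (auto simp: filterlim_at_split)
  then have "((\<lambda>u::real. u / sin u) \<longlongrightarrow> 1) (at_right 0)"
    by simp
  then have "((\<lambda>u::real. (u / sin u) * cos u - 1 - ln ((2 * cos u + 1) / 3))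
      \<longlongrightarrow> 1 * cos 0 - 1 - ln ((2 * cos 0 + 1) / 3)) (at_right 0)"
    by (intro tendsto_intros) auto
  then have "(f \<longlongrightarrow> 0) (at_right 0)"
    by (simp add: f_def[abs_def])
  \<comment> \<open>A limit yields only a weak inequality; comparing at \<open>x / 2\<close> leaves
    room for the strict step to \<open>f x\<close>.\<close>
  moreover have "\<forall>\<^sub>F u in at_right 0. f u \<le> f (x / 2)"
    using mono[of _ "x / 2"] assms
    by (auto simp: eventually_at_right_field intro!: exI[of _ "x / 2"] less_imp_le)
  ultimately have "0 \<le> f (x / 2)"
    by (rule tendsto_upperbound) simp
  also have "\<dots> < f x"
    using assms by (intro mono) auto
  finally have "ln ((2 * cos x + 1) / 3) < x * cot x - 1"
    by (simp add: f_def cot_def)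
  moreover have "(2 * cos x + 1) / 3 > 0"
    using pos[of x] assms by simp
  ultimately show ?thesis
    using exp_less_cancel_iff[of "ln ((2 * cos x + 1) / 3)"] by simp
qed

lemma less_mean_X:
  assumes "a > 0" "b > 0" "a \<noteq> b"
  shows "(2 * mean_G a b + mean_A a b) / 3 < mean_X a b"
proof -
  define d where "d = \<bar>a - b\<bar> / (a + b)"
  define x where "x = arcsin d"
  have d: "0 < d" "d < 1"
    using assms by (auto simp: d_def abs_if)
  have x: "0 < x" "x < pi / 2"
    using d arcsin_less_arcsin[of 0 d] arcsin_lt_bounded[of d] by (auto simp: x_def)
  have sin_x: "sin x = d"
    using d by (simp add: x_def)
  have A: "mean_A a b > 0"
    using assms by (simp add: mean_A_def)
  \<comment> \<open>The right-hand side is \<open>(G / A)^2\<close>, which identifies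
    \<open>cos x\<close> with \<open>G / A\<close>.\<close>
  have "1 - d\<^sup>2 = 4 * (a * b) / (a + b)\<^sup>2"
    using assms by (simp add: d_def power_divide divide_simps) (simp add: power2_eq_square algebra_simps)
  then have "cos x = sqrt (4 * (a * b) / (a + b)\<^sup>2)"
    using d by (simp add: x_def cos_arcsin)
  also have "\<dots> = mean_G a b / mean_A a b"
    using assms by (simp add: mean_G_def mean_A_def real_sqrt_divide real_sqrt_mult)
  finally have G: "mean_G a b = mean_A a b * cos x"
    using A by simp
  \<comment> \<open>As \<open>arcsin\<close> is odd, numerator and denominator of \<open>P\<close>
    change sign together when \<open>a < b\<close>. Hence \<open>P = A * sin x / x\<close> and
    \<open>G / P = x * cot x\<close>.\<close>
  have "mean_P a b = \<bar>a - b\<bar> / (2 * x)"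
  proof (cases "a > b")
    case False
    then have "(a - b) / (a + b) = - d"
      by (simp add: d_def abs_if minus_divide_left del: divide_minus_left)
    then have "arcsin ((a - b) / (a + b)) = - x"
      using d by (simp add: x_def arcsin_minus)
    then show ?thesis
      using False by (simp add: mean_P_def minus_divide_left del: divide_minus_left)
  qed (simp add: mean_P_def x_def d_def)
  also have "\<bar>a - b\<bar> = 2 * mean_A a b * sin x"
    using assms by (simp add: sin_x d_def mean_A_def)
  finally have "mean_P a b = mean_A a b * sin x / x"
    by simp
  then have "mean_X a b = mean_A a b * exp (x * cot x - 1)"
    using A by (simp add: mean_X_def G cot_def)
  moreover have "(2 * mean_G a b + mean_A a b) / 3 = mean_A a b * ((2 * cos x + 1) / 3)"
    by (simp add: G algebra_simps)
  ultimately show ?thesis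
    using A cos_rational_less_exp_cot[OF x] by (simp only: mult_strict_left_mono)
qed

theorem theorem2p22:
  fixes a b :: real
  assumes "a > 0" and "b > 0" and "a \<noteq> b"
  shows "(\<forall>p::real. p \<le> 1/3 \<longrightarrow>
            power_mean p a b \<le> power_mean (1/3) a b \<and>
            power_mean (1/3) a b < (2 * mean_G a b + mean_A a b) / 3 \<and>
            (2 * mean_G a b + mean_A a b) / 3 < mean_X a b) \<and>
         (\<forall>\<alpha>::real. \<alpha> \<le> 1/2 \<longrightarrow>
            heronian_mean \<alpha> a b \<le> heronian_mean (1/2) a b \<and>
            heronian_mean (1/2) a b < (2 * mean_G a b + mean_A a b) / 3 \<and>
            (2 * mean_G a b + mean_A a b) / 3 < mean_X a b)"
  by (intro conjI allI impI power_mean_le heronian_mean_le power_mean_third_less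
      heronian_mean_half_less less_mean_X assms) simp_all

end
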